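(* Let $P(\lambda)$ be an $n\times n$ complex matrix polynomial of degree $m$ with nonsingular leading coefficient, and let $w$ be a weight polynomial as in the context. If $P(\lambda)$ has exactly $k$ $(\le nm)$ distinct eigenvalues (not necessarily simple), then for any $\varepsilon>0$ the pseudospectrum $\Lambda_\varepsilon(P)$ has at most $k$ connected components.
   Context: $P(\lambda)=P_m\lambda^m+\cdots+P_1\lambda+P_0$ with $m\ge 1$, $P_j\in\mathbb{C}^{n\times n}$ and $\det P_m\neq 0$. The eigenvalues of $P(\lambda)$ are the zeros of $\det P(\lambda)$. The weight polynomial is $w(x)=\sum_{j=0}^m w_jx^j$ with real $w_j\ge 0$ for $j=1,\dots,m$ and $w_0>0$. $\|\cdot\|$ is the spectral matrix norm. For $\varepsilon\ge 0$, $\mathcal{B}(P,\varepsilon,w)$ is the set of matrix polynomials $Q(\lambda)=\sum_{j=0}^m(P_j+\Delta_j)\lambda^j$ with $\Delta_j\in\mathbb{C}^{n\times n}$ and $\|\Delta_j\|\le\varepsilon w_j$ for $j=0,\dots,m$. The $\varepsilon$-pseudospectrum of $P(\lambda)$ is $\Lambda_\varepsilon(P)=\{\mu\in\mathbb{C}:\det Q(\mu)=0\text{ for some }Q\in\mathcal{B}(P,\varepsilon,w)\}$; equivalently $\Lambda_\varepsilon(P)=\{\lambda\in\mathbb{C}: s_n(\lambda)\le\varepsilon w(|\lambda|)\}$, where $s_n(\lambda)$ is the smallest singular value of $P(\lambda)$. *)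

theory Defs
  imports "HOL-Analysis.Analysis" "HOL-Computational_Algebra.Polynomial"
begin

text \<open>
  An \<open>n \<times> n\<close> complex matrix polynomial is a polynomial with coefficients in
  \<^typ>\<open>complex^'n^'n\<close>, where \<open>n = CARD('n)\<close>. The library's \<^const>\<open>poly\<close> does not evaluate
  it at a scalar: it takes an argument of the coefficient type, and its product on
  \<^typ>\<open>complex^'n^'n\<close> is componentwise. The
  product \<open>mat (z ^ j) ** A\<close> is the scalar multiple of \<open>A\<close> by the complex number \<open>z ^ j\<close>.
\<close>

definition matpoly_eval :: "(complex^'n^'n) poly \<Rightarrow> complex \<Rightarrow> complex^'n^'n" where
  "matpoly_eval P z = (\<Sum>j\<le>degree P. mat (z ^ j) ** coeff P j)"

definition matpoly_eigenvalues :: "(complex^'n^'n) poly \<Rightarrow> complex set" where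
  "matpoly_eigenvalues P = {z. det (matpoly_eval P z) = 0}"

text \<open>
  The norm of \<^typ>\<open>complex^'n\<close> is the Euclidean one, so the spectral norm is the operator norm
  of \<open>(*v) A\<close>. The library norm of the type \<^typ>\<open>complex^'n^'n\<close> is the Frobenius norm.
\<close>

definition spectral_norm :: "complex^'n^'n \<Rightarrow> real" where
  "spectral_norm A = onorm ((*v) A)"

text \<open>
  A weight polynomial for matrix polynomials of degree \<open>m\<close>; its leading coefficients,
  including the one of index \<open>m\<close>, may vanish.
\<close>

definition weight_poly :: "nat \<Rightarrow> real poly \<Rightarrow> bool" where
  "weight_poly m w \<longleftrightarrow>
     degree w \<le> m \<and> (\<forall>j\<in>{1..m}. coeff w j \<ge> 0) \<and> coeff w 0 > 0"

definition perturbations ::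
  "(complex^'n^'n) poly \<Rightarrow> real \<Rightarrow> real poly \<Rightarrow> (complex^'n^'n) poly set" where
  "perturbations P \<epsilon> w =
     {P + \<Delta> | \<Delta>. degree \<Delta> \<le> degree P \<and>
        (\<forall>j\<le>degree P. spectral_norm (coeff \<Delta> j) \<le> \<epsilon> * coeff w j)}"

definition pseudospectrum ::
  "(complex^'n^'n) poly \<Rightarrow> real \<Rightarrow> real poly \<Rightarrow> complex set" where
  "pseudospectrum P \<epsilon> w =
     {\<mu>. \<exists>Q\<in>perturbations P \<epsilon> w. det (matpoly_eval Q \<mu>) = 0}"

end

theory Submission imports Defs "HOL-Complex_Analysis.Complex_Analysis" begin

text \<open>
  Every component of the pseudospectrum contains an eigenvalue; as distinct components are
  disjoint, there are at most as many components as eigenvalues. The obstacle to finding the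
  eigenvalue is that the pseudospectrum may be unbounded, because perturbed leading coefficients
  may be singular. A component could then a priori run off to infinity, and two components may
  touch there.

  The pseudospectrum is reduced to superlevel sets of single rational functions. Let \<open>z\<^sub>0\<close> belong
  to it. A perturbation that makes \<open>P z\<^sub>0\<close> singular can be replaced by \<open>W z\<^sub>0\<close> times a matrix \<open>B\<close> of
  rank at most one with \<open>\<parallel>B\<parallel> \<le> \<epsilon>\<close>, where \<open>W\<close> is the weight polynomial with its argument rotated so that
  \<open>W z\<^sub>0 = w \<bar>z\<^sub>0\<bar>\<close> (\<open>rank_one_shift_at_pseudospectrum_point\<close>). Because of the rank of \<open>B\<close>, the determinant
  of \<open>P z + s W z B\<close> is affine in \<open>s\<close> (\<open>det_rank_one_affine\<close>), that is, equal to
  \<open>det (P z) (1 + s F z)\<close> for a rational function \<open>F\<close> whose poles are eigenvalues. All \<open>s\<close> with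
  \<open>\<bar>s\<bar> \<le> 1\<close> give admissible perturbations, so the pseudospectrum contains the set where
  \<open>\<bar>F\<bar> \<ge> 1\<close>, together with the eigenvalues, and \<open>F z\<^sub>0 = -1\<close> unless \<open>z\<^sub>0\<close> is itself an eigenvalue.
  Because the leading coefficient of \<open>P\<close> is nonsingular, \<open>F\<close> has a finite limit at infinity.

  It remains to see that each component of \<open>{\<bar>F\<bar> \<ge> 1}\<close> joined with the eigenvalues contains an
  eigenvalue (\<open>superlevel_component_meets_poles\<close>). This is the maximum modulus principle on the
  Riemann sphere. It is applied to the open set \<open>{\<bar>F\<bar> > 1}\<close>, since the closed set may have components
  that meet only at infinity.
\<close>

text \<open>The dollar sign denotes vector components here, not coefficients of power series.\<close>

unbundle no fps_syntax

section \<open>Superlevel sets of holomorphic functions on the sphere\<close>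

lemma connected_complement_finite_complex:
  fixes Z :: "complex set"
  assumes "finite Z"
  shows "connected (- Z)"
  using path_connected_complement_countable[of Z] assms
  by (simp add: countable_finite path_connected_imp_connected)

lemma constant_if_constant_on_open:
  fixes F :: "complex \<Rightarrow> complex"
  assumes "finite Z" "F holomorphic_on -Z"
    and "open T" "T \<noteq> {}" "T \<subseteq> -Z" "F constant_on T"
  shows "F constant_on -Z"
proof -
  obtain c where c: "\<And>z. z \<in> T \<Longrightarrow> F z = c"
    using assms(6) unfolding constant_on_def by auto
  have "F z = c" if "z \<in> -Z" for z
    by (rule analytic_continuation_open[of T "-Z" F "\<lambda>_. c"])
       (use assms c that connected_complement_finite_complex in \<open>auto simp: finite_imp_closed\<close>)
  then show ?thesis unfolding constant_on_def by blast
qed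

text \<open>
  In the coordinate \<open>1/z\<close> the function has a removable singularity at \<open>0\<close>, with value \<open>L\<close>, and its
  modulus is maximal there. So the point at infinity obeys the maximum modulus principle too.
\<close>

lemma constant_if_norm_max_at_infinity:
  fixes F :: "complex \<Rightarrow> complex"
  assumes "finite Z" "F holomorphic_on -Z" "(F \<longlongrightarrow> L) at_infinity"
    and R: "R > 0" "\<And>z. R < norm z \<Longrightarrow> z \<notin> Z" "\<And>z. R < norm z \<Longrightarrow> norm (F z) \<le> norm L"
  shows "F constant_on -Z"
proof -
  define B where "B = ball (0::complex) (1/R)"
  define G where "G = (\<lambda>t. if t = 0 then L else F (inverse t))"
  have far: "R < norm (inverse t)" if "t \<in> B - {0}" for t
    using that R(1) by (auto simp: B_def norm_divide field_simps)
  have "(\<lambda>t. F (inverse t)) holomorphic_on B - {0}"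
    by (rule holomorphic_on_compose_gen[of inverse "B - {0}" F "-Z", unfolded o_def])
       (use assms(2) far R(2) in \<open>auto intro!: holomorphic_intros\<close>)
  then have G1: "G holomorphic_on B - {0}"
    by (rule holomorphic_transform) (simp add: G_def)
  have "((\<lambda>t. F (inverse t)) \<longlongrightarrow> L) (at 0)"
    using assms(3) unfolding lim_at_infinity_0 by (simp add: o_def)
  then have "(G \<longlongrightarrow> L) (at 0)"
    by (rule Lim_transform_eventually) (auto simp: G_def eventually_at intro!: exI[of _ 1])
  then have G0: "(G \<longlongrightarrow> G 0) (at 0 within B)"
    using Lim_at_imp_Lim_at_within by (simp add: G_def)
  have oB: "open B" by (simp add: B_def)
  have G: "G holomorphic_on B"
    by (rule no_isolated_singularity'[OF _ G1 oB]) (simp_all add: G0)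
  have "G constant_on B"
  proof (rule maximum_modulus_principle[OF G, of B 0])
    show "norm (G t) \<le> norm (G 0)" if "t \<in> B" for t
      using R(3)[OF far[of t]] that by (cases "t = 0") (simp_all add: G_def)
  qed (use R(1) in \<open>simp_all add: B_def\<close>)
  then obtain c where c: "\<And>t. t \<in> B \<Longrightarrow> G t = c" unfolding constant_on_def by auto
  have FR: "F z = c" if "R < norm z" for z
  proof -
    have z: "z \<noteq> 0" "0 < norm z" using that R(1) by auto
    then have "inverse z \<in> B" using that R(1) by (simp add: B_def norm_inverse norm_divide field_simps)
    from c[OF this] show ?thesis using z by (simp add: G_def)
  qed
  have op: "open {z::complex. R < norm z}"
    by (intro open_Collect_less continuous_intros)
  have "norm (of_real (R+1) :: complex) > R" using R(1) by simp
  then have ne: "{z::complex. R < norm z} \<noteq> {}" by blast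
  show ?thesis
    by (rule constant_if_constant_on_open[OF assms(1,2) op ne])
       (use R(2) FR in \<open>auto simp: constant_on_def\<close>)
qed

text \<open>
  If the closure of \<open>U\<close> avoided \<open>Z\<close>, then \<open>F\<close> would be bounded on \<open>U\<close>, with modulus \<open>1\<close> on the boundary
  and larger inside. The supremum of the modulus would then be attained in \<open>U\<close> or approached only
  at infinity. In the second case \<open>\<bar>L\<bar> > 1\<close>, so \<open>U\<close> is a neighbourhood of infinity on which the modulus
  is at most \<open>\<bar>L\<bar>\<close>. Both cases contradict the maximum modulus principle, as \<open>F\<close> is not constant.
\<close>

lemma closure_component_meets_poles:
  fixes F :: "complex \<Rightarrow> complex"
  assumes fin: "finite Z" and hol: "F holomorphic_on -Z" and lim: "(F \<longlongrightarrow> L) at_infinity"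
    and nonconst: "\<not> F constant_on -Z"
    and U: "U \<in> components {z. z \<notin> Z \<and> 1 < norm (F z)}"
  shows "closure U \<inter> Z \<noteq> {}"
proof
  assume disj: "closure U \<inter> Z = {}"
  define V where "V = {z. z \<notin> Z \<and> 1 < norm (F z)}"
  have oZ: "open (-Z)" using finite_imp_closed[OF fin] by (rule open_Compl)
  have cont: "continuous_on (-Z) (\<lambda>z. norm (F z))"
    using hol by (intro continuous_intros holomorphic_on_imp_continuous_on)
  have "V = {z \<in> -Z. norm (F z) \<in> {1<..}}" by (auto simp: V_def)
  then have oV: "open V"
    using continuous_open_preimage[OF cont oZ, of "{1<..}"] by (simp add: vimage_def Int_def)
  have UV: "U \<in> components V" using U by (simp add: V_def)
  then have Usub: "U \<subseteq> V" and oU: "open U" and Une: "U \<noteq> {}"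
    using in_components_subset[OF UV] open_components[OF oV UV] in_components_nonempty[OF UV] by auto
  have U_Z: "U \<subseteq> -Z" using Usub by (auto simp: V_def)
  \<comment> \<open>Points of the closure where the modulus still exceeds \<open>1\<close> are not boundary points.\<close>
  have closedU: "v \<in> U" if "v \<in> closure U" "v \<in> V" for v
  proof -
    have "connected (insert v U)"
      by (rule connected_intermediate_closure[OF in_components_connected[OF UV]])
         (use that closure_subset in auto)
    then show ?thesis
      using components_maximal[OF UV, of "insert v U"] Usub that Une by auto
  qed
  have no_max: False if v: "v \<in> U" "\<And>z. z \<in> U \<Longrightarrow> norm (F z) \<le> norm (F v)" for v
    using maximum_modulus_principle[OF hol oZ connected_complement_finite_complex[OF fin] oU U_Z v]
      nonconst by blast
  \<comment> \<open>If \<open>\<bar>F\<bar>\<close> were below \<open>\<bar>F u\<bar>\<close> outside a disc, its maximum over the compact part of the closure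
    of \<open>U\<close> inside that disc would be a maximum over \<open>U\<close>.\<close>
  have large_far: "\<exists>z\<in>U. R < norm z \<and> norm (F u) \<le> norm (F z)" if u: "u \<in> U" for R u
  proof (rule ccontr)
    assume neg: "\<not> (\<exists>z\<in>U. R < norm z \<and> norm (F u) \<le> norm (F z))"
    define T where "T = closure U \<inter> cball 0 R"
    have uT: "u \<in> T" using u neg closure_subset[of U] by (force simp: T_def)
    have "compact T" by (auto simp: T_def closed_Int_compact)
    moreover have "continuous_on T (\<lambda>z. norm (F z))"
      by (rule continuous_on_subset[OF cont]) (use disj in \<open>auto simp: T_def\<close>)
    ultimately obtain v where v: "v \<in> T" "\<And>z. z \<in> T \<Longrightarrow> norm (F z) \<le> norm (F v)"
      using continuous_attains_sup[of T] uT by blast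
    have "1 < norm (F u)" using u Usub by (auto simp: V_def)
    then have "v \<in> V" using v(1) v(2)[OF uT] disj by (auto simp: T_def V_def)
    then have "v \<in> U" using closedU v(1) by (auto simp: T_def)
    moreover have "norm (F z) \<le> norm (F v)" if "z \<in> U" for z
    proof (cases "norm z \<le> R")
      case True
      then show ?thesis using v(2)[of z] that closure_subset[of U] by (auto simp: T_def)
    next
      case False
      then have "norm (F z) < norm (F u)" using neg that by force
      then show ?thesis using v(2)[OF uT] by linarith
    qed
    ultimately show False using no_max by blast
  qed
  have lim': "((\<lambda>z. norm (F z)) \<longlongrightarrow> norm L) at_infinity" using lim by (rule tendsto_norm)
  have le_L: "norm (F u) \<le> norm L" if u: "u \<in> U" for u
  proof (rule ccontr)
    assume "\<not> ?thesis"
    then have "eventually (\<lambda>z. norm (F z) < norm (F u)) at_infinity"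
      using order_tendstoD(2)[OF lim'] by auto
    then obtain b where b: "\<And>z. b \<le> norm z \<Longrightarrow> norm (F z) < norm (F u)"
      unfolding eventually_at_infinity by auto
    show False using large_far[OF u, of b] b by (meson less_imp_le not_less)
  qed
  obtain u where u: "u \<in> U" using Une by blast
  then have "1 < norm L" using le_L[OF u] Usub by (auto simp: V_def)
  then have "eventually (\<lambda>z. 1 < norm (F z)) at_infinity"
    using order_tendstoD(1)[OF lim'] by auto
  then obtain b where b: "\<And>z. b \<le> norm z \<Longrightarrow> 1 < norm (F z)"
    unfolding eventually_at_infinity by auto
  obtain b' where b': "\<And>z. z \<in> Z \<Longrightarrow> norm z \<le> b'"
    using finite_imp_bounded[OF fin] unfolding bounded_iff by auto
  define R where "R = max 1 (max b b')"
  have R: "R > 0" "\<And>z. R < norm z \<Longrightarrow> z \<notin> Z" "\<And>z. R < norm z \<Longrightarrow> z \<in> V"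
    using b b' by (force simp: R_def V_def)+
  obtain z1 where z1: "z1 \<in> U" "R < norm z1" using large_far[OF u, of R] by auto
  have "connected (- cball (0::complex) R)"
    by (intro connected_complement_bounded_convex) auto
  moreover have "- cball (0::complex) R \<subseteq> V" using R(3) by auto
  moreover have "U \<inter> (- cball 0 R) \<noteq> {}" using z1 by force
  ultimately have "- cball 0 R \<subseteq> U" using components_maximal[OF UV] by blast
  then have "norm (F z) \<le> norm L" if "R < norm z" for z
    using le_L[of z] that by (auto simp: subset_iff)
  then have "F constant_on -Z"
    using constant_if_norm_max_at_infinity[OF fin hol lim R(1,2)] by blast
  then show False using nonconst by blast
qed

text \<open>
  Each component of the open set \<open>{\<bar>F\<bar> > 1}\<close> is joined to a point of \<open>Z\<close> by its closure, so the open set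
  lies in the union \<open>K\<close> of the components through \<open>Z\<close>. There are finitely many of these, hence \<open>K\<close> is
  closed. A point with \<open>\<bar>F\<bar> \<ge> 1\<close> outside \<open>K\<close> would have a neighbourhood with \<open>\<bar>F\<bar> \<le> 1\<close> and
  therefore be a local maximum, which a nonconstant \<open>F\<close> does not have.
\<close>

proposition superlevel_component_meets_poles:
  fixes F :: "complex \<Rightarrow> complex"
  assumes fin: "finite Z" and "Z \<noteq> {}"
    and hol: "F holomorphic_on -Z" and lim: "(F \<longlongrightarrow> L) at_infinity"
    and C: "C \<in> components (Z \<union> {z. 1 \<le> norm (F z)})"
  shows "C \<inter> Z \<noteq> {}"
proof (cases "F constant_on -Z")
  case True
  then obtain c where c: "\<And>z. z \<notin> Z \<Longrightarrow> F z = c" unfolding constant_on_def by auto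
  show ?thesis
  proof (cases "1 \<le> norm c")
    case True
    then have "Z \<union> {z. 1 \<le> norm (F z)} = UNIV" using c by auto
    then have "C = UNIV"
      using C by (simp add: components_def connected_component_eq_UNIV[THEN iffD1] connected_UNIV)
    then show ?thesis using assms(2) by auto
  next
    case False
    then have "Z \<union> {z. 1 \<le> norm (F z)} = Z" using c by force
    then have "C \<subseteq> Z" using in_components_subset[OF C] by auto
    then show ?thesis using in_components_nonempty[OF C] by blast
  qed
next
  case nonconst: False
  define S where "S = Z \<union> {z. 1 \<le> norm (F z)}"
  define V where "V = {z. z \<notin> Z \<and> 1 < norm (F z)}"
  have oZ: "open (-Z)" using finite_imp_closed[OF fin] by (rule open_Compl)
  have cont: "continuous_on (-Z) (\<lambda>z. norm (F z))"
    using hol by (intro continuous_intros holomorphic_on_imp_continuous_on)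
  have "- S = {z \<in> -Z. norm (F z) \<in> {..<1}}" by (auto simp: S_def)
  then have "open (- S)"
    using continuous_open_preimage[OF cont oZ, of "{..<1}"] by (simp add: vimage_def Int_def)
  then have clS: "closed S" by (simp add: closed_def)
  have VS: "V \<subseteq> S" by (auto simp: V_def S_def)
  define K where "K = (\<Union>e\<in>Z. connected_component_set S e)"
  have clK: "closed K"
    unfolding K_def by (intro closed_UN fin ballI closed_connected_component clS)
  have VK: "V \<subseteq> K"
  proof
    fix v assume v: "v \<in> V"
    define U where "U = connected_component_set V v"
    have U: "U \<in> components V" using v by (auto simp: U_def components_def)
    then obtain e where e: "e \<in> closure U" "e \<in> Z"
      using closure_component_meets_poles[OF fin hol lim nonconst] unfolding V_def by blast
    have "closure U \<subseteq> S"
      using in_components_subset[OF U] VS clS by (meson closure_minimal order_trans)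
    moreover have "connected (closure U)"
      using in_components_connected[OF U] by (rule connected_imp_connected_closure)
    moreover have "v \<in> closure U"
      using v closure_subset[of U] by (auto simp: U_def)
    ultimately have "connected_component S e v"
      using e(1) unfolding connected_component_def by blast
    then show "v \<in> K" using e(2) by (auto simp: K_def)
  qed
  have SK: "S \<subseteq> K"
  proof
    fix z assume z: "z \<in> S"
    show "z \<in> K"
    proof (cases "z \<in> Z")
      case True
      moreover have "z \<in> connected_component_set S z"
        unfolding mem_Collect_eq by (rule connected_component_refl[OF z])
      ultimately show ?thesis unfolding K_def by (rule UN_I)
    next
      case False
      show ?thesis
      proof (rule ccontr)
        assume "z \<notin> K"
        define T where "T = - K \<inter> - Z"
        have "open T" using clK oZ by (auto simp: T_def)
        moreover have "z \<in> T" using False \<open>z \<notin> K\<close> by (simp add: T_def)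
        moreover have "norm (F t) \<le> norm (F z)" if "t \<in> T" for t
        proof -
          have "t \<notin> V" using that VK by (auto simp: T_def)
          then have "norm (F t) \<le> 1" using that by (auto simp: V_def T_def)
          also have "1 \<le> norm (F z)" using z False by (auto simp: S_def)
          finally show ?thesis .
        qed
        ultimately show False
          using maximum_modulus_principle[OF hol oZ connected_complement_finite_complex[OF fin], of T z]
            nonconst by (auto simp: T_def)
      qed
    qed
  qed
  obtain z where z: "z \<in> S" "C = connected_component_set S z"
    using C by (auto simp: components_def S_def)
  then obtain e where e: "e \<in> Z" "connected_component S e z"
    using SK by (auto simp: K_def)
  then have "e \<in> C" using z(2) connected_component_sym by fastforce
  then show ?thesis using e(1) by blast
qed


section \<open>Determinants of matrix polynomials\<close>

lemma mat_mult_component: "(mat a ** A) $ i $ j = a * A $ i $ j"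
  for A :: "'a::semiring_1^'n^'m"
  by (simp add: matrix_matrix_mult_def mat_def if_distrib if_distribR cong: if_cong)

lemma mat_0_mult: "mat 0 ** A = 0" for A :: "'a::semiring_1^'n^'m"
  by (simp add: vec_eq_iff mat_mult_component)

lemma matpoly_eval_component:
  assumes "degree Q \<le> m"
  shows "matpoly_eval Q z $ a $ b = (\<Sum>j\<le>m. z ^ j * coeff Q j $ a $ b)"
proof -
  have "matpoly_eval Q z $ a $ b = (\<Sum>j\<le>degree Q. z ^ j * coeff Q j $ a $ b)"
    by (simp add: matpoly_eval_def mat_mult_component)
  also have "\<dots> = (\<Sum>j\<le>m. z ^ j * coeff Q j $ a $ b)"
    by (rule sum.mono_neutral_left) (use assms in \<open>auto simp: coeff_eq_0\<close>)
  finally show ?thesis .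
qed

lemma matpoly_eval_add: "matpoly_eval (P + Q) z = matpoly_eval P z + matpoly_eval Q z"
proof -
  define m where "m = max (degree P) (degree Q)"
  have "degree P \<le> m" "degree Q \<le> m" "degree (P + Q) \<le> m"
    by (auto simp: m_def degree_add_le_max)
  then show ?thesis
    by (simp add: vec_eq_iff matpoly_eval_component algebra_simps sum.distrib)
qed

lemma holomorphic_on_det_matpoly_eval: "(\<lambda>z. det (matpoly_eval Q z)) holomorphic_on S"
  unfolding det_def matpoly_eval_component[OF order_refl]
  by (intro holomorphic_intros)

text \<open>
  The entries of \<open>Q z\<close> divided by \<open>z ^ m\<close> tend to those of the coefficient of index \<open>m\<close>, and the
  determinant is continuous. The degree of \<open>Q\<close> may be smaller than \<open>m\<close>; perturbed polynomials need this.
\<close>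

lemma tendsto_det_matpoly_eval:
  fixes Q :: "(complex^'n^'n) poly"
  assumes "degree Q \<le> m"
  shows "((\<lambda>z. det (matpoly_eval Q z) / (z ^ m) ^ CARD('n)) \<longlongrightarrow> det (coeff Q m)) at_infinity"
proof -
  define R where "R z = (\<chi> a b. \<Sum>j\<le>m. coeff Q j $ a $ b * inverse z ^ (m - j))" for z
  have "((\<lambda>z. R z $ a $ b) \<longlongrightarrow> coeff Q m $ a $ b) at_infinity" for a b
  proof -
    have "((\<lambda>z. R z $ a $ b) \<longlongrightarrow> (\<Sum>j\<le>m. coeff Q j $ a $ b * 0 ^ (m - j))) at_infinity"
      unfolding R_def by (auto intro!: tendsto_intros tendsto_inverse_0)
    also have "(\<Sum>j\<le>m. coeff Q j $ a $ b * 0 ^ (m - j)) = (\<Sum>j\<in>{m}. coeff Q j $ a $ b * 0 ^ (m - j))"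
      by (rule sum.mono_neutral_right) auto
    finally show ?thesis by simp
  qed
  then have lim: "((\<lambda>z. det (R z)) \<longlongrightarrow> det (coeff Q m)) at_infinity"
    unfolding det_def by (intro tendsto_sum tendsto_mult tendsto_const tendsto_prod)
  have "det (R z) = det (matpoly_eval Q z) / (z ^ m) ^ CARD('n)" if "z \<noteq> 0" for z
  proof -
    have "matpoly_eval Q z $ a $ b = z ^ m * R z $ a $ b" for a b
    proof -
      have "z ^ m * inverse z ^ (m - j) = z ^ j" if "j \<le> m" for j
      proof -
        have "z ^ m = z ^ j * z ^ (m - j)" using that by (simp flip: power_add)
        then show ?thesis using \<open>z \<noteq> 0\<close> by (simp add: power_inverse)
      qed
      then have "(\<Sum>j\<le>m. z ^ j * coeff Q j $ a $ b)
          = (\<Sum>j\<le>m. z ^ m * inverse z ^ (m - j) * coeff Q j $ a $ b)"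
        by (intro sum.cong) auto
      then show ?thesis
        by (simp add: R_def matpoly_eval_component[OF assms] sum_distrib_left mult_ac)
    qed
    then have "matpoly_eval Q z = (\<chi> a. z ^ m *s R z $ a)"
      by (simp add: vec_eq_iff)
    then show ?thesis using that by (simp add: det_rows_mul)
  qed
  then have "eventually (\<lambda>z. det (R z) = det (matpoly_eval Q z) / (z ^ m) ^ CARD('n)) at_infinity"
    by (intro eventually_mono[OF eventually_not_equal_at_infinity[of 0]]) simp
  then show ?thesis by (rule Lim_transform_eventually[OF lim])
qed

text \<open>Otherwise the reciprocal of the determinant would be entire and vanish at infinity.\<close>

lemma matpoly_eigenvalues_nonempty:
  fixes P :: "(complex^'n^'n) poly"
  assumes "degree P \<ge> 1" "det (coeff P (degree P)) \<noteq> 0"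
  shows "matpoly_eigenvalues P \<noteq> {}"
proof
  assume "matpoly_eigenvalues P = {}"
  then have nz: "det (matpoly_eval P z) \<noteq> 0" for z by (auto simp: matpoly_eigenvalues_def)
  have "((\<lambda>z::complex. (inverse z ^ degree P) ^ CARD('n)) \<longlongrightarrow> (0 ^ degree P) ^ CARD('n)) at_infinity"
    by (intro tendsto_intros tendsto_inverse_0)
  then have "((\<lambda>z::complex. inverse ((z ^ degree P) ^ CARD('n))) \<longlongrightarrow> 0) at_infinity"
    using assms(1) by (simp add: power_inverse power_0_left)
  from tendsto_divide[OF this tendsto_det_matpoly_eval[OF order_refl] assms(2)]
  have "((\<lambda>z. inverse ((z ^ degree P) ^ CARD('n)) /
      (det (matpoly_eval P z) / (z ^ degree P) ^ CARD('n))) \<longlongrightarrow> 0) at_infinity" by simp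
  then have "((\<lambda>z. inverse (det (matpoly_eval P z))) \<longlongrightarrow> 0) at_infinity"
  proof (rule Lim_transform_eventually)
    show "eventually (\<lambda>z. inverse ((z ^ degree P) ^ CARD('n)) /
      (det (matpoly_eval P z) / (z ^ degree P) ^ CARD('n)) = inverse (det (matpoly_eval P z))) at_infinity"
      by (intro eventually_mono[OF eventually_not_equal_at_infinity[of 0]]) (simp add: divide_simps)
  qed
  moreover have "(\<lambda>z. inverse (det (matpoly_eval P z))) holomorphic_on UNIV"
    using nz by (intro holomorphic_intros holomorphic_on_det_matpoly_eval) auto
  ultimately have "inverse (det (matpoly_eval P 0)) = 0" by (rule Liouville_weak_0[rotated])
  then show False using nz by simp
qed

text \<open>
  If \<open>v $ k \<noteq> 0\<close>, subtracting multiples of row \<open>k\<close> clears \<open>s B\<close> from all other rows. These row operations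
  do not depend on \<open>s\<close>, so \<open>s\<close> remains in row \<open>k\<close> only, in which the determinant is linear.
\<close>

lemma det_rank_one_affine:
  fixes A :: "'a::field^'n^'n" and v u :: "'a^'n"
  defines "B \<equiv> \<chi> i j. v $ i * u $ j"
  shows "det (A + mat s ** B) = det A + s * (det (A + B) - det A)"
proof (cases "v = 0")
  case True
  then have "B = 0" by (simp add: B_def vec_eq_iff)
  then have "mat s ** B = 0" by (simp add: vec_eq_iff mat_mult_component)
  with \<open>B = 0\<close> show ?thesis by simp
next
  case False
  then obtain k where k: "v $ k \<noteq> 0" by (auto simp: vec_eq_iff)
  define a where "a i = (if i = k then 0 else v $ i / v $ k)" for i
  \<comment> \<open>Left multiplication by \<open>L\<close> subtracts \<open>a i\<close> times row \<open>k\<close> from row \<open>i\<close>.\<close>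
  define L :: "'a^'n^'n" where
    "L = (\<chi> i j. (if i = j then 1 else 0) - (if k = j then a i else 0))"
  have "(\<Sum>j\<in>UNIV. (if i = j then c else 0) * x $ j) = c * x $ i" for c i and x :: "'a^'n"
  proof -
    have "(if i = j then c else 0) * x $ j = (if i = j then c * x $ j else 0)" for j by simp
    then show ?thesis by simp
  qed
  then have Lv: "(L *v x) $ i = x $ i - a i * x $ k" for x i
    by (simp add: L_def matrix_vector_mult_def left_diff_distrib sum_subtractf)
  have "x = 0" if "L *v x = 0" for x
  proof -
    have *: "x $ i = a i * x $ k" for i
      using Lv[of x i] that by simp
    from *[of k] have "x $ k = 0" by (simp add: a_def)
    with * have "x $ i = 0" for i by (metis mult_zero_right)
    then show ?thesis by (simp add: vec_eq_iff)
  qed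
  then have "invertible L"
    unfolding invertible_left_inverse matrix_left_invertible_ker by blast
  then have detL: "det L \<noteq> 0" by (simp add: invertible_det_nz)
  define C where "C = (\<lambda>i. A $ i - (v $ i / v $ k) *s A $ k)"
  have LA: "L ** (A + mat t ** B) = (\<chi> i. if i = k then A $ k + (t * v $ k) *s u else C i)" for t
  proof -
    have LM: "(L ** M) $ i $ j = M $ i $ j - a i * M $ k $ j" for M i j
      using Lv[of "column j M" i] by (simp add: matrix_matrix_mult_def matrix_vector_mult_def column_def)
    have "(L ** (A + mat t ** B)) $ i $ j = (if i = k then A $ k + (t * v $ k) *s u else C i) $ j" for i j
      using k unfolding LM by (cases "i = k") (simp_all add: mat_mult_component a_def B_def C_def algebra_simps)
    then show ?thesis by (simp add: vec_eq_iff)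
  qed
  define p q where "p = det (\<chi> i. if i = k then A $ k else C i)"
    and "q = det (\<chi> i. if i = k then u else C i)"
  have eq: "det L * det (A + mat t ** B) = p + t * (v $ k * q)" for t
    using det_row_add[of k "\<lambda>_. A $ k" "\<lambda>_. (t * v $ k) *s u" C]
      det_row_mul[of k "t * v $ k" "\<lambda>_. u" C]
    by (simp add: det_mul[symmetric] LA p_def q_def mult.assoc)
  have "det L * det A = p" using eq[of 0] by (simp add: mat_0_mult)
  moreover have "det L * det (A + B) = p + v $ k * q" using eq[of 1] by simp
  ultimately have "det L * det (A + mat s ** B) = det L * (det A + s * (det (A + B) - det A))"
    using eq[of s] by (simp add: algebra_simps)
  then show ?thesis using detL by simp
qed

section \<open>Spectral norm and rank-one perturbations\<close>

lemma mat_mult_vector: "(mat a ** A) *v x = a *s (A *v x)" for A :: "'a::comm_semiring_1^'n^'m"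
  by (simp add: vec_eq_iff matrix_vector_mult_def mat_mult_component sum_distrib_left mult.assoc)

lemma norm_smult_vec: "norm (a *s x) = norm a * norm x" for x :: "complex^'n"
  by (simp add: norm_vec_def norm_mult L2_set_right_distrib)

lemma norm_mult_vec_le_spectral_norm: "norm (A *v x) \<le> spectral_norm A * norm x"
  unfolding spectral_norm_def by (rule onorm) simp

lemma spectral_norm_mat_mult_le: "spectral_norm (mat a ** A) \<le> norm a * spectral_norm A"
  unfolding spectral_norm_def[of "mat a ** A"]
proof (rule onorm_le)
  fix x
  show "norm ((mat a ** A) *v x) \<le> norm a * spectral_norm A * norm x"
    using mult_left_mono[OF norm_mult_vec_le_spectral_norm[of A x], of "norm a"]
    by (simp add: mat_mult_vector norm_smult_vec mult.assoc)
qed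

text \<open>
  The map sends \<open>t\<close> to \<open>y\<close> times the inner product of \<open>x\<close> and \<open>t\<close>, divided by \<open>\<parallel>x\<parallel>\<^sup>2\<close>; the norm bound is the
  Cauchy-Schwarz inequality.
\<close>

lemma rank_one_map_to:
  fixes x y :: "complex^'n"
  assumes "x \<noteq> 0" "norm y \<le> \<epsilon> * norm x"
  obtains v u where "(\<chi> i j. v $ i * u $ j) *v x = y" "spectral_norm (\<chi> i j. v $ i * u $ j) \<le> \<epsilon>"
proof -
  define u :: "complex^'n" where "u = (\<chi> i. cnj (x $ i) / of_real ((norm x)\<^sup>2))"
  define B :: "complex^'n^'n" where "B = (\<chi> i j. y $ i * u $ j)"
  have nx: "norm x > 0" using assms(1) by simp
  have Bt: "B *v t = (\<Sum>j\<in>UNIV. u $ j * t $ j) *s y" for t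
    by (simp add: B_def vec_eq_iff matrix_vector_mult_def sum_distrib_left sum_distrib_right mult_ac)
  have "(\<Sum>j\<in>UNIV. u $ j * x $ j) = of_real (\<Sum>j\<in>UNIV. (norm (x $ j))\<^sup>2) / of_real ((norm x)\<^sup>2)"
    by (simp add: u_def sum_divide_distrib complex_norm_square[symmetric] mult.commute[of "cnj _"])
  also have "(\<Sum>j\<in>UNIV. (norm (x $ j))\<^sup>2) = (norm x)\<^sup>2"
    by (simp add: norm_vec_def L2_set_def sum_nonneg)
  finally have "B *v x = y" using nx by (simp add: Bt)
  moreover have "spectral_norm B \<le> \<epsilon>"
    unfolding spectral_norm_def
  proof (rule onorm_le)
    fix t
    have "norm (\<Sum>j\<in>UNIV. u $ j * t $ j) \<le> (\<Sum>j\<in>UNIV. \<bar>norm (x $ j)\<bar> * \<bar>norm (t $ j)\<bar>) / (norm x)\<^sup>2"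
      unfolding sum_divide_distrib
      by (rule order_trans[OF norm_sum]) (simp add: u_def norm_mult norm_divide norm_power)
    also have "\<dots> \<le> norm x * norm t / (norm x)\<^sup>2"
      unfolding norm_vec_def by (intro divide_right_mono L2_set_mult_ineq) auto
    also have "\<dots> = norm t / norm x" using nx by (simp add: power2_eq_square)
    finally have "norm (B *v t) \<le> norm t / norm x * norm y"
      unfolding Bt norm_smult_vec by (intro mult_right_mono) auto
    also have "\<dots> \<le> norm t / norm x * (\<epsilon> * norm x)"
      by (intro mult_left_mono assms(2)) auto
    also have "\<dots> = \<epsilon> * norm t" using nx by simp
    finally show "norm (B *v t) \<le> \<epsilon> * norm t" .
  qed
  ultimately show thesis using that[of y u] unfolding B_def by blast
qed

lemma det_eq_0_kernel:
  fixes A :: "'a::field^'n^'n"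
  shows "det A = 0 \<longleftrightarrow> (\<exists>x. x \<noteq> 0 \<and> A *v x = 0)"
  using invertible_det_nz[of A] unfolding invertible_left_inverse matrix_left_invertible_ker by blast

definition matpoly_of :: "nat \<Rightarrow> (nat \<Rightarrow> complex^'n^'n) \<Rightarrow> (complex^'n^'n) poly" where
  "matpoly_of m D = (\<Sum>j\<le>m. monom (D j) j)"

lemma coeff_matpoly_of: "coeff (matpoly_of m D) j = (if j \<le> m then D j else 0)"
  by (simp add: matpoly_of_def coeff_sum)

lemma degree_matpoly_of: "degree (matpoly_of m D) \<le> m"
  by (rule degree_le) (simp add: coeff_matpoly_of)

text \<open>
  For a unimodular \<open>c\<close> this is a polynomial in \<open>z\<close> bounded in modulus by the weight at \<open>\<bar>z\<bar>\<close>, with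
  equality where \<open>c * z = \<bar>z\<bar>\<close>. It is a holomorphic substitute for the weight near such a point.
\<close>

definition twisted_weight :: "nat \<Rightarrow> real poly \<Rightarrow> complex \<Rightarrow> complex \<Rightarrow> complex" where
  "twisted_weight m w c z = (\<Sum>j\<le>m. of_real (coeff w j) * (c * z) ^ j)"

text \<open>
  The coefficients distribute \<open>s * twisted_weight m w c z\<close> times \<open>B\<close> over the powers of \<open>z\<close>, so that each
  one is \<open>B\<close> times a scalar of modulus at most \<open>coeff w j\<close> when \<open>\<bar>s\<bar> \<le> 1\<close> and \<open>\<bar>c\<bar> = 1\<close>.
\<close>

definition rank_one_shift ::
  "nat \<Rightarrow> real poly \<Rightarrow> complex \<Rightarrow> complex^'n^'n \<Rightarrow> complex \<Rightarrow> (complex^'n^'n) poly" where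
  "rank_one_shift m w c B s = matpoly_of m (\<lambda>j. mat (s * of_real (coeff w j) * c ^ j) ** B)"

lemma matpoly_eval_rank_one_shift:
  "matpoly_eval (rank_one_shift m w c B s) z = mat s ** (mat (twisted_weight m w c z) ** B)"
  by (simp add: vec_eq_iff rank_one_shift_def twisted_weight_def mat_mult_component
      matpoly_eval_component[OF degree_matpoly_of] coeff_matpoly_of sum_distrib_left sum_distrib_right
      power_mult_distrib mult_ac)

lemma weight_poly_coeff_nonneg: "weight_poly m w \<Longrightarrow> coeff w j \<ge> 0"
  by (cases "j = 0"; cases "j \<le> m") (auto simp: weight_poly_def coeff_eq_0)

lemma mem_pseudospectrumI:
  assumes w: "weight_poly (degree P) w" and c: "norm c = 1"
    and B: "spectral_norm B \<le> \<epsilon>" and s: "norm s \<le> 1" and \<epsilon>: "\<epsilon> > 0"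
    and det: "det (matpoly_eval (P + rank_one_shift (degree P) w c B s) z) = 0"
  shows "z \<in> pseudospectrum P \<epsilon> w"
proof -
  let ?D = "rank_one_shift (degree P) w c B s"
  have "spectral_norm (coeff ?D j) \<le> \<epsilon> * coeff w j" if "j \<le> degree P" for j
  proof -
    have w0: "coeff w j \<ge> 0" by (rule weight_poly_coeff_nonneg[OF w])
    have "spectral_norm (coeff ?D j) \<le> norm (s * of_real (coeff w j) * c ^ j) * spectral_norm B"
      using that spectral_norm_mat_mult_le by (simp add: rank_one_shift_def coeff_matpoly_of)
    also have "\<dots> = norm s * coeff w j * spectral_norm B"
      using c w0 by (simp add: norm_mult norm_power)
    also have "\<dots> \<le> norm s * coeff w j * \<epsilon>"
      by (intro mult_left_mono B) (use w0 in auto)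
    also have "\<dots> \<le> 1 * coeff w j * \<epsilon>"
      by (intro mult_right_mono s) (use w0 \<epsilon> in auto)
    finally show ?thesis by (simp add: mult.commute)
  qed
  moreover have "degree ?D \<le> degree P" by (simp add: rank_one_shift_def degree_matpoly_of)
  ultimately show ?thesis
    using det unfolding pseudospectrum_def perturbations_def by blast
qed

text \<open>
  Let \<open>D\<close> be a perturbation with \<open>(P + D) z\<close> singular and \<open>x\<close> a kernel vector. Only the vector
  \<open>(D z) x\<close> matters for the singularity, and its norm is at most \<open>\<epsilon> w(\<bar>z\<bar>) \<parallel>x\<parallel>\<close>. A rank-one map scaled
  by the weight sends \<open>x\<close> to the same vector.
\<close>

lemma rank_one_shift_at_pseudospectrum_point:
  fixes P :: "(complex^'n^'n) poly"
  assumes w: "weight_poly (degree P) w" and z: "z \<in> pseudospectrum P \<epsilon> w"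
  obtains c v u where "norm c = 1" "spectral_norm (\<chi> i j. v $ i * u $ j) \<le> \<epsilon>"
    "det (matpoly_eval (P + rank_one_shift (degree P) w c (\<chi> i j. v $ i * u $ j) 1) z) = 0"
proof -
  define m where "m = degree P"
  obtain D where D: "degree D \<le> m" "\<And>j. j \<le> m \<Longrightarrow> spectral_norm (coeff D j) \<le> \<epsilon> * coeff w j"
    "det (matpoly_eval (P + D) z) = 0"
    using z unfolding pseudospectrum_def perturbations_def m_def by auto
  obtain x where x: "x \<noteq> 0" "matpoly_eval (P + D) z *v x = 0"
    using D(3) det_eq_0_kernel by blast
  define r where "r = (\<Sum>j\<le>m. coeff w j * norm z ^ j)"
  have nonneg: "coeff w j \<ge> 0" for j by (rule weight_poly_coeff_nonneg[OF w])
  have "0 < coeff w 0 * norm z ^ 0" using w by (simp add: weight_poly_def)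
  also have "\<dots> \<le> r" unfolding r_def by (rule member_le_sum) (use nonneg in auto)
  finally have r: "r > 0" .
  define c where "c = (if z = 0 then 1 else cnj z / of_real (norm z))"
  have c: "norm c = 1" by (simp add: c_def norm_divide)
  have cz: "c * z = of_real (norm z)"
    using complex_norm_square[of z] by (auto simp: c_def power2_eq_square field_simps)
  have Wz: "twisted_weight m w c z = of_real r"
    by (simp add: twisted_weight_def r_def cz)
  have Dx: "norm (matpoly_eval D z *v x) \<le> r * (\<epsilon> * norm x)"
  proof -
    have "matpoly_eval D z = (\<Sum>j\<le>m. mat (z ^ j) ** coeff D j)"
      by (simp add: vec_eq_iff matpoly_eval_component[OF D(1)] mat_mult_component)
    moreover have "(\<Sum>j\<le>m. A j) *v x = (\<Sum>j\<le>m. A j *v x)" for A :: "nat \<Rightarrow> complex^'n^'n"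
      by (induction m) (simp_all add: matrix_vector_mult_add_rdistrib)
    ultimately have "matpoly_eval D z *v x = (\<Sum>j\<le>m. z ^ j *s (coeff D j *v x))"
      by (simp add: mat_mult_vector)
    then have "norm (matpoly_eval D z *v x) \<le> (\<Sum>j\<le>m. norm z ^ j * norm (coeff D j *v x))"
      by (simp add: sum_norm_le norm_smult_vec norm_power)
    also have "\<dots> \<le> (\<Sum>j\<le>m. norm z ^ j * (\<epsilon> * coeff w j * norm x))"
      by (intro sum_mono mult_left_mono order_trans[OF norm_mult_vec_le_spectral_norm]
          mult_right_mono D(2)) auto
    also have "\<dots> = r * (\<epsilon> * norm x)"
      by (simp add: r_def sum_distrib_left sum_distrib_right mult_ac)
    finally show ?thesis .
  qed
  define y where "y = inverse (of_real r) *s (matpoly_eval D z *v x)"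
  have "norm y \<le> \<epsilon> * norm x"
    using Dx r by (simp add: y_def norm_smult_vec norm_divide field_simps)
  then obtain v u where vu: "(\<chi> i j. v $ i * u $ j) *v x = y"
      "spectral_norm (\<chi> i j. v $ i * u $ j) \<le> \<epsilon>"
    using rank_one_map_to[OF x(1)] by blast
  have "of_real r *s y = matpoly_eval D z *v x"
    using r by (simp add: y_def vector_smult_assoc)
  then have "matpoly_eval (P + rank_one_shift m w c (\<chi> i j. v $ i * u $ j) 1) z *v x = 0"
    using x(2) by (simp add: matpoly_eval_add matrix_vector_mult_add_rdistrib
        matpoly_eval_rank_one_shift mat_mult_vector Wz vu(1))
  then have "det (matpoly_eval (P + rank_one_shift m w c (\<chi> i j. v $ i * u $ j) 1) z) = 0"
    using x(1) det_eq_0_kernel by blast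
  then show thesis using that[OF c vu(2)] by (simp add: m_def)
qed

section \<open>Components of the pseudospectrum\<close>

proposition pseudospectrum_component_meets_eigenvalues:
  fixes P :: "(complex^'n^'n) poly"
  assumes deg: "degree P \<ge> 1" and lead: "det (coeff P (degree P)) \<noteq> 0"
    and w: "weight_poly (degree P) w" and fin: "finite (matpoly_eigenvalues P)" and \<epsilon>: "\<epsilon> > 0"
    and C: "C \<in> components (pseudospectrum P \<epsilon> w)"
  shows "C \<inter> matpoly_eigenvalues P \<noteq> {}"
proof -
  define Z where "Z = matpoly_eigenvalues P"
  define m where "m = degree P"
  obtain z where z: "z \<in> C" "z \<in> pseudospectrum P \<epsilon> w"
    using in_components_nonempty[OF C] in_components_subset[OF C] by blast
  obtain c v u where c: "norm c = 1" and vu: "spectral_norm (\<chi> i j. v $ i * u $ j) \<le> \<epsilon>"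
    and det: "det (matpoly_eval (P + rank_one_shift m w c (\<chi> i j. v $ i * u $ j) 1) z) = 0"
    using rank_one_shift_at_pseudospectrum_point[OF w z(2)] unfolding m_def by blast
  define B :: "complex^'n^'n" where "B = (\<chi> i j. v $ i * u $ j)"
  define Q where "Q = P + rank_one_shift m w c B 1"
  have degQ: "degree Q \<le> m"
    by (simp add: Q_def degree_add_le m_def rank_one_shift_def degree_matpoly_of)
  define F where "F z = det (matpoly_eval Q z) / det (matpoly_eval P z) - 1" for z
  have affine: "det (matpoly_eval (P + rank_one_shift m w c B s) z) = det (matpoly_eval P z) * (1 + s * F z)"
    if "z \<notin> Z" for s z
  proof -
    let ?W = "twisted_weight m w c z"
    have "mat ?W ** B = (\<chi> i j. (?W *s v) $ i * u $ j)"
      by (simp add: vec_eq_iff mat_mult_component B_def mult.assoc)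
    from det_rank_one_affine[of "matpoly_eval P z" s "?W *s v" u, folded this]
    have "det (matpoly_eval (P + rank_one_shift m w c B s) z)
      = det (matpoly_eval P z) + s * (det (matpoly_eval Q z) - det (matpoly_eval P z))"
      by (simp add: Q_def matpoly_eval_add matpoly_eval_rank_one_shift)
    moreover have "det (matpoly_eval P z) \<noteq> 0"
      using that by (simp add: Z_def matpoly_eigenvalues_def)
    ultimately show ?thesis by (simp add: F_def divide_simps)
  qed
  have sub: "Z \<union> {z. 1 \<le> norm (F z)} \<subseteq> pseudospectrum P \<epsilon> w"
  proof
    fix t assume t: "t \<in> Z \<union> {z. 1 \<le> norm (F z)}"
    \<comment> \<open>This is the zero of \<open>1 + s F t\<close>; at an eigenvalue no perturbation is needed.\<close>
    define s where "s = (if t \<in> Z then 0 else - inverse (F t))"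
    have "norm s \<le> 1" using t by (auto simp: s_def norm_inverse inverse_le_1_iff)
    moreover have "det (matpoly_eval (P + rank_one_shift m w c B s) t) = 0"
    proof (cases "t \<in> Z")
      case True
      then have "det (matpoly_eval P t) = 0" by (simp add: Z_def matpoly_eigenvalues_def)
      with True show ?thesis
        by (simp add: s_def matpoly_eval_add matpoly_eval_rank_one_shift mat_0_mult)
    next
      case False
      then have "F t \<noteq> 0" using t by auto
      then show ?thesis using False by (simp add: affine s_def)
    qed
    ultimately show "t \<in> pseudospectrum P \<epsilon> w"
      using mem_pseudospectrumI[OF w c vu _ \<epsilon>] unfolding m_def B_def by blast
  qed
  \<comment> \<open>The numerator of the quotient in \<open>F z\<close> vanishes, so \<open>F z = -1\<close>, also when the denominator is \<open>0\<close>.\<close>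
  have "z \<in> Z \<union> {z. 1 \<le> norm (F z)}" using det by (simp add: F_def Q_def B_def)
  then obtain C' where C': "C' \<in> components (Z \<union> {z. 1 \<le> norm (F z)})" "z \<in> C'"
    using Union_components by blast
  have "Z \<noteq> {}" using matpoly_eigenvalues_nonempty[OF deg lead] by (simp add: Z_def)
  moreover have "F holomorphic_on -Z"
    unfolding F_def
    by (intro holomorphic_intros holomorphic_on_det_matpoly_eval) (auto simp: Z_def matpoly_eigenvalues_def)
  moreover have "(F \<longlongrightarrow> det (coeff Q m) / det (coeff P m) - 1) at_infinity"
  proof -
    let ?g = "\<lambda>z::complex. (z ^ m) ^ CARD('n)"
    have "((\<lambda>z. (det (matpoly_eval Q z) / ?g z) / (det (matpoly_eval P z) / ?g z) - 1)
        \<longlongrightarrow> det (coeff Q m) / det (coeff P m) - 1) at_infinity"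
      using lead by (intro tendsto_intros tendsto_det_matpoly_eval) (simp_all add: degQ[unfolded m_def] m_def)
    then show ?thesis
    proof (rule Lim_transform_eventually)
      show "eventually (\<lambda>z. (det (matpoly_eval Q z) / ?g z) / (det (matpoly_eval P z) / ?g z) - 1 = F z)
          at_infinity"
        by (intro eventually_mono[OF eventually_not_equal_at_infinity[of 0]]) (simp add: F_def)
    qed
  qed
  ultimately have "C' \<inter> Z \<noteq> {}"
    using superlevel_component_meets_poles[OF fin[folded Z_def] _ _ _ C'(1)] by blast
  moreover have "C' \<subseteq> C"
    using components_maximal[OF C in_components_connected[OF C'(1)]]
      in_components_subset[OF C'(1)] sub C'(2) z(1) by blast
  ultimately show ?thesis unfolding Z_def by blast
qed

theorem theorem12:
  fixes P :: "(complex^'n^'n) poly" and w :: "real poly" and m k :: nat and \<epsilon> :: real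
  assumes "m \<ge> 1"
    and "degree P = m"
    and "det (coeff P m) \<noteq> 0"
    and "weight_poly m w"
    and "finite (matpoly_eigenvalues P)"
    and "card (matpoly_eigenvalues P) = k"
    and "\<epsilon> > 0"
  shows "finite (components (pseudospectrum P \<epsilon> w)) \<and>
         card (components (pseudospectrum P \<epsilon> w)) \<le> k"
proof -
  let ?S = "pseudospectrum P \<epsilon> w" and ?Z = "matpoly_eigenvalues P"
  have "components ?S \<subseteq> connected_component_set ?S ` ?Z"
  proof
    fix C assume C: "C \<in> components ?S"
    then obtain e where e: "e \<in> C" "e \<in> ?Z"
      using pseudospectrum_component_meets_eigenvalues[of P w \<epsilon> C] assms by blast
    have "C = connected_component_set ?S e"
      using C e(1) by (metis componentsE connected_component_eq)
    then show "C \<in> connected_component_set ?S ` ?Z" using e(2) by blast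
  qed
  then show ?thesis
    using assms(5,6) surj_card_le[of ?Z] finite_subset[OF _ finite_imageI] by blast
qed

end
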